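(* Let $m\ge 3$ and $r\ge 1$ be integers with $2^r+1>m$. Set $$n=2^r+1,\qquad k=n-m,\qquad d=(n-1)(2^{k+1}-2)+k.$$ Then $1\le k<n$, and $$\beta(d)>n\quad\Longleftrightarrow\quad r\ge m+\alpha(m-3).$$
   Context: For a non-negative integer $t$, $\alpha(t)$ is the number of $1$'s in the binary expansion of $t$ (so $\alpha(0)=0$). For a non-negative integer $d$, $$\beta(d)=\min\{s\in\mathbb Z_{\ge0}\mid d=(2^{i_1}-1)+\cdots+(2^{i_s}-1)\text{ for some } i_1,\dots,i_s\in\mathbb Z_{\ge0}\}.$$ *)

theory Defs
  imports Main
begin

definition alpha :: "nat \<Rightarrow> nat" where
  "alpha t = card {i. bit t i}"

definition beta :: "nat \<Rightarrow> nat" where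
  "beta d = (LEAST s. \<exists>is :: nat list. length is = s \<and> d = (\<Sum>i\<leftarrow>is. 2 ^ i - 1))"

text \<open>The two lemmas below exclude the degenerate values of \<open>card\<close> (infinite set) and
  of \<open>LEAST\<close> (empty set).\<close>

lemma finite_bits_nat: "finite {i. bit (t :: nat) i}"
proof (rule finite_subset)
  show "{i. bit t i} \<subseteq> {..<t}"
  proof
    fix i assume "i \<in> {i. bit t i}"
    then have "t div 2 ^ i \<noteq> 0"
      by (auto simp: bit_iff_odd intro: odd_pos)
    then have "2 ^ i \<le> t"
      by (simp add: div_eq_0_iff not_less)
    then show "i \<in> {..<t}"
      using less_le_trans[OF less_exp] by simp
  qed
qed simp

lemma beta_attained:
  "\<exists>is :: nat list. length is = beta d \<and> d = (\<Sum>i\<leftarrow>is. 2 ^ i - 1)"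
proof -
  have "length (replicate d (1::nat)) = d \<and> d = (\<Sum>i\<leftarrow>replicate d 1. 2 ^ i - 1)"
    by (simp add: sum_list_replicate)
  then have "\<exists>is :: nat list. length is = d \<and> d = (\<Sum>i\<leftarrow>is. 2 ^ i - 1)"
    by blast
  then show ?thesis
    unfolding beta_def by (rule LeastI)
qed

end

theory Submission
  imports Defs
begin

text \<open>Adding \<open>1\<close> to each of \<open>s\<close> summands \<open>2 ^ i - 1\<close> turns a representation of \<open>d\<close> into one of
  \<open>d + s\<close> as a sum of \<open>s\<close> powers of two, and a number \<open>N \<ge> s\<close> is such a sum iff \<open>alpha N \<le> s\<close>.
  So \<open>beta d > n\<close> iff \<open>alpha (d + n) > n\<close>. Here \<open>d + n = 2 ^ N - 1 - (m - 3)\<close> with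
  \<open>N = r + k + 1\<close>, and complementing the bits gives \<open>alpha (d + n) = N - alpha (m - 3)\<close>.\<close>

lemma alpha_0 [simp]: "alpha 0 = 0"
  by (simp add: alpha_def)

lemma alpha_double [simp]: "alpha (2 * a) = alpha a"
proof -
  have "{i. bit (2 * a) i} = Suc ` {i. bit a i}"
  proof (rule set_eqI)
    fix i show "i \<in> {i. bit (2 * a) i} \<longleftrightarrow> i \<in> Suc ` {i. bit a i}"
      by (cases i) (auto simp: bit_0 bit_Suc)
  qed
  then show ?thesis
    by (simp add: alpha_def card_image)
qed

lemma alpha_Suc_double [simp]: "alpha (Suc (2 * a)) = Suc (alpha a)"
proof -
  have "{i. bit (Suc (2 * a)) i} = insert 0 (Suc ` {i. bit a i})"
  proof (rule set_eqI)
    fix i show "i \<in> {i. bit (Suc (2 * a)) i} \<longleftrightarrow> i \<in> insert 0 (Suc ` {i. bit a i})"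
      by (cases i) (auto simp: bit_0 bit_Suc)
  qed
  then show ?thesis
    by (simp add: alpha_def card_image finite_bits_nat)
qed

lemma alpha_Suc_le: "alpha (Suc a) \<le> Suc (alpha a)"
proof (induction a rule: less_induct)
  case (less a)
  show ?case
  proof (cases "even a")
    case True
    then obtain b where "a = 2 * b" ..
    then show ?thesis by simp
  next
    case False
    then obtain b where b: "a = Suc (2 * b)" by (auto elim: oddE)
    then have "alpha (Suc a) = alpha (Suc b)"
      using alpha_double[of "Suc b"] by simp
    also have "\<dots> \<le> Suc (alpha b)"
      using less.IH[of b] b by simp
    finally show ?thesis using b by simp
  qed
qed

text \<open>Adding \<open>2 ^ Suc i\<close> leaves the lowest bit of \<open>a\<close> untouched, so
  stripping that bit lowers the exponent by one; at exponent \<open>0\<close> the claim is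
  \<open>alpha_Suc_le\<close>.\<close>

lemma alpha_add_power_le: "alpha (a + 2 ^ i) \<le> Suc (alpha a)"
proof (induction i arbitrary: a)
  case 0
  show ?case using alpha_Suc_le[of a] by simp
next
  case (Suc i)
  show ?case
  proof (cases "even a")
    case True
    then obtain b where b: "a = 2 * b" ..
    then have "a + 2 ^ Suc i = 2 * (b + 2 ^ i)" by simp
    then show ?thesis using Suc.IH[of b] b alpha_double by metis
  next
    case False
    then obtain b where b: "a = Suc (2 * b)" by (auto elim: oddE)
    then have "a + 2 ^ Suc i = Suc (2 * (b + 2 ^ i))" by simp
    then show ?thesis using Suc.IH[of b] b alpha_Suc_double by (metis Suc_le_mono)
  qed
qed

lemma alpha_sum_powers_le: "alpha (\<Sum>i\<leftarrow>is. 2 ^ i) \<le> length is"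
proof (induction "is")
  case (Cons i "is")
  then show ?case
    using alpha_add_power_le[of "\<Sum>i\<leftarrow>is. 2 ^ i" i] by (simp add: add.commute)
qed simp

text \<open>Induction by halving. An odd \<open>N\<close> gives up one summand \<open>1\<close>. For
  even \<open>N\<close>, few summands are obtained by doubling a representation of
  \<open>N / 2\<close>, and many by using only ones and twos.\<close>

lemma sum_powers_exists:
  assumes "alpha N \<le> s" and "s \<le> N"
  shows "\<exists>is :: nat list. length is = s \<and> N = (\<Sum>i\<leftarrow>is. 2 ^ i)"
  using assms
proof (induction N arbitrary: s rule: less_induct)
  case (less N)
  show ?case
  proof (cases "even N")
    case True
    then obtain a where a: "N = 2 * a" ..
    consider "N = 0" | "N > 0" "s \<le> a" | "s > a" by linarith
    then show ?thesis
    proof cases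
      case 1
      then show ?thesis using less.prems by simp
    next
      case 2
      then obtain "is" :: "nat list" where "length is = s" "a = (\<Sum>i\<leftarrow>is. 2 ^ i)"
        using less.IH[of a s] less.prems a by auto
      then have "length (map Suc is) = s \<and> N = (\<Sum>i\<leftarrow>map Suc is. 2 ^ i)"
        using a by (simp add: o_def sum_list_const_mult)
      then show ?thesis by blast
    next
      case 3
      \<comment> \<open>With \<open>x\<close> twos and \<open>y\<close> ones, the equations
        \<open>x + y = s\<close> and \<open>2 * x + y = 2 * a\<close> force these multiplicities;
        \<open>s \<le> N\<close> and \<open>s > a\<close> keep both subtractions exact.\<close>
      let ?is = "replicate (2 * a - s) 1 @ replicate (2 * s - 2 * a) (0 :: nat)"
      have "length ?is = s \<and> N = (\<Sum>i\<leftarrow>?is. 2 ^ i)"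
        using 3 a less.prems by (simp add: sum_list_replicate)
      then show ?thesis by blast
    qed
  next
    case False
    then obtain a where a: "N = Suc (2 * a)" by (auto elim: oddE)
    then obtain t where t: "s = Suc t" using less.prems by (cases s) auto
    obtain "is" :: "nat list" where "length is = t" "2 * a = (\<Sum>i\<leftarrow>is. 2 ^ i)"
      using less.IH[of "2 * a" t] less.prems a t by auto
    then have "length (0 # is) = s \<and> N = (\<Sum>i\<leftarrow>0 # is. 2 ^ i)"
      using a t by simp
    then show ?thesis by blast
  qed
qed

lemma sum_pred_powers_add_length:
  "(\<Sum>i\<leftarrow>is. 2 ^ i - 1) + length is = (\<Sum>i\<leftarrow>is. 2 ^ i :: nat)"
proof (induction "is")
  case (Cons i "is")
  have "(2 :: nat) ^ i \<ge> 1" by simp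
  then show ?case
    using Cons unfolding list.map list.size sum_list.Cons by linarith
qed simp

lemma beta_le_iff: "beta d \<le> s \<longleftrightarrow> alpha (d + s) \<le> s"
proof
  assume le: "beta d \<le> s"
  obtain "is" :: "nat list" where len: "length is = beta d" and d: "d = (\<Sum>i\<leftarrow>is. 2 ^ i - 1)"
    using beta_attained by blast
  \<comment> \<open>Exponent \<open>0\<close> contributes \<open>2 ^ 0 - 1 = 0\<close>, so a shorter
    representation can be padded to length exactly \<open>s\<close>.\<close>
  let ?js = "is @ replicate (s - beta d) 0"
  have "d = (\<Sum>i\<leftarrow>?js. 2 ^ i - 1)" and "length ?js = s"
    using le len d by (simp_all add: sum_list_replicate)
  then show "alpha (d + s) \<le> s"
    by (metis sum_pred_powers_add_length alpha_sum_powers_le)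
next
  assume "alpha (d + s) \<le> s"
  then obtain "is" :: "nat list" where len: "length is = s" and "d + s = (\<Sum>i\<leftarrow>is. 2 ^ i)"
    using sum_powers_exists[of "d + s" s] by auto
  then have "d = (\<Sum>i\<leftarrow>is. 2 ^ i - 1)"
    using sum_pred_powers_add_length[of "is"] by simp
  then show "beta d \<le> s"
    unfolding beta_def using len by (intro Least_le) blast
qed

text \<open>Subtracting from \<open>2 ^ N - 1\<close> flips each of the \<open>N\<close> low bits,
  so every position is counted exactly once. The induction peels off the lowest bit.\<close>

lemma alpha_complement:
  assumes "t < 2 ^ N"
  shows "alpha (2 ^ N - 1 - t) + alpha t = N"
  using assms
proof (induction N arbitrary: t)
  case (Suc N)
  show ?case
  proof (cases "even t")
    case True
    then obtain a where a: "t = 2 * a" ..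
    then have "a < 2 ^ N"
      using Suc.prems by simp
    moreover have "2 ^ Suc N - 1 - t = Suc (2 * (2 ^ N - 1 - a))"
      using a Suc.prems unfolding power_Suc by linarith
    ultimately show ?thesis using Suc.IH[of a] a
      by (simp only: alpha_double alpha_Suc_double add_Suc)
  next
    case False
    then obtain a where a: "t = Suc (2 * a)" by (auto elim: oddE)
    then have "2 ^ Suc N - 1 - t = 2 * (2 ^ N - 1 - a)" and "a < 2 ^ N"
      using Suc.prems by simp_all
    then show ?thesis using Suc.IH[of a] a
      by (simp only: alpha_double alpha_Suc_double add_Suc_right)
  qed
qed simp

theorem theorem4p7:
  fixes m r n k d :: nat
  assumes "m \<ge> 3" and "r \<ge> 1" and "2 ^ r + 1 > m"
    and "n = 2 ^ r + 1"
    and "k = n - m"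
    and "d = (n - 1) * (2 ^ (k + 1) - 2) + k"
  shows "1 \<le> k \<and> k < n \<and> (beta d > n \<longleftrightarrow> r \<ge> m + alpha (m - 3))"
proof -
  let ?N = "r + k + 1"
  have k: "k + m = 2 ^ r + 1" "1 \<le> k" "k < n"
    using assms by auto
  have N: "(2 :: nat) ^ ?N = 2 ^ r * 2 ^ (k + 1)"
    by (simp add: power_add)
  have pow: "(2 :: nat) ^ ?N \<ge> 2 * 2 ^ r"
    by (simp add: N)
  have "d = 2 ^ ?N - 2 * 2 ^ r + k"
    unfolding N using assms(4,6) by (simp add: diff_mult_distrib2)
  \<comment> \<open>Substituting \<open>n = 2 ^ r + 1\<close> and \<open>k = 2 ^ r + 1 - m\<close>
    cancels every \<open>2 ^ r\<close> and leaves \<open>2 ^ ?N + 2 - m\<close>.\<close>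
  then have "d + n = 2 ^ ?N - 1 - (m - 3)"
    using k pow assms(1,4) by linarith
  moreover have "m - 3 < 2 ^ ?N"
    using k pow assms(1) by linarith
  ultimately have "alpha (d + n) + alpha (m - 3) = ?N"
    using alpha_complement by metis
  \<comment> \<open>Since \<open>n = k + m\<close>, the term \<open>k\<close> cancels from
    \<open>r + k + 1 - alpha (m - 3) > n\<close>, and the remaining \<open>1\<close> turns the
    strict inequality into a weak one.\<close>
  then have "alpha (d + n) > n \<longleftrightarrow> r \<ge> m + alpha (m - 3)"
    using k assms(4) by linarith
  then show ?thesis
    using k beta_le_iff[of d n] by (simp add: not_le[symmetric])
qed

end
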